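(* A geodesic metric space $X$ is hyperbolic if and only if $$\liminf_{t\to\infty}\frac{G_X(t)}{t}>30.$$
   Context: Let $(X,d)$ be a metric space. A map $\gamma\colon[0,1]\to X$ is a geodesic if there is $k\ge 0$ with $d(\gamma(t),\gamma(s))=k|t-s|$ for all $t,s\in[0,1]$; geodesics are identified with their images, and $[x,y]$ denotes a geodesic joining $x$ to $y$ (not necessarily unique). $X$ is geodesic if any two of its points can be joined by a geodesic. A triangle is the union of three geodesics (its sides) joining three points pairwise. A triangle with sides $\ell_1,\ell_2,\ell_3$ satisfies the Rips condition with constant $\delta$ if, whenever $\{i,j,k\}=\{1,2,3\}$, every point of $\ell_i$ is at distance at most $\delta$ from $\ell_j\cup\ell_k$. A geodesic space is $\delta$-hyperbolic if every triangle in it satisfies the Rips condition with constant $\delta$, and hyperbolic if it is $\delta$-hyperbolic for some $\delta\ge 0$. For $t>0$, a $t$-detour in $X$ is a continuous map $\gamma\colon[0,1]\to X$ such that there exist a geodesic $[\gamma(0),\gamma(1)]$ and a point $z\in[\gamma(0),\gamma(1)]$ with $d(z,\mathrm{Im}\,\gamma)\ge t$. The detour growth function $G_X\colon(0,\infty)\to(0,\infty]$ is $G_X(t)=\inf\{\mathrm{length}(\gamma):\ \gamma \text{ is a } t\text{-detour}\}$, where the length may be infinite and $G_X(t)=\infty$ if there are no rectifiable $t$-detours. *)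

theory Defs
  imports "HOL-Analysis.Analysis"
begin

text \<open>
  A metric space is given as a set \<open>X\<close> in a type of class \<open>metric_space\<close>, with the induced
  distance; \<open>X = UNIV\<close> is allowed. Parameters of maps range over the interval \<open>{0..1}\<close> only:
  values outside it are irrelevant.
\<close>

definition geodesic :: "'a::metric_space set \<Rightarrow> (real \<Rightarrow> 'a) \<Rightarrow> bool" where
  "geodesic X g \<longleftrightarrow> g ` {0..1} \<subseteq> X \<and>
     (\<exists>k\<ge>0. \<forall>t\<in>{0..1}. \<forall>s\<in>{0..1}. dist (g t) (g s) = k * \<bar>t - s\<bar>)"

text \<open>\<open>L\<close> is (the image of) some geodesic \<open>[x,y]\<close> in \<open>X\<close>.\<close>

definition geodesic_between :: "'a::metric_space set \<Rightarrow> 'a \<Rightarrow> 'a \<Rightarrow> 'a set \<Rightarrow> bool" where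
  "geodesic_between X x y L \<longleftrightarrow>
     (\<exists>g. geodesic X g \<and> g 0 = x \<and> g 1 = y \<and> L = g ` {0..1})"

definition geodesic_space :: "'a::metric_space set \<Rightarrow> bool" where
  "geodesic_space X \<longleftrightarrow> (\<forall>x\<in>X. \<forall>y\<in>X. \<exists>L. geodesic_between X x y L)"

definition triangle_sides ::
  "'a::metric_space set \<Rightarrow> 'a set \<Rightarrow> 'a set \<Rightarrow> 'a set \<Rightarrow> bool" where
  "triangle_sides X L1 L2 L3 \<longleftrightarrow>
     (\<exists>x y z. geodesic_between X x y L1 \<and> geodesic_between X y z L2 \<and> geodesic_between X z x L3)"

definition rips_condition ::
  "real \<Rightarrow> 'a::metric_space set \<Rightarrow> 'a set \<Rightarrow> 'a set \<Rightarrow> bool" where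
  "rips_condition \<delta> L1 L2 L3 \<longleftrightarrow>
     (\<forall>p\<in>L1. infdist p (L2 \<union> L3) \<le> \<delta>) \<and>
     (\<forall>p\<in>L2. infdist p (L1 \<union> L3) \<le> \<delta>) \<and>
     (\<forall>p\<in>L3. infdist p (L1 \<union> L2) \<le> \<delta>)"

definition delta_hyperbolic :: "'a::metric_space set \<Rightarrow> real \<Rightarrow> bool" where
  "delta_hyperbolic X \<delta> \<longleftrightarrow> geodesic_space X \<and>
     (\<forall>L1 L2 L3. triangle_sides X L1 L2 L3 \<longrightarrow> rips_condition \<delta> L1 L2 L3)"

definition hyperbolic :: "'a::metric_space set \<Rightarrow> bool" where
  "hyperbolic X \<longleftrightarrow> (\<exists>\<delta>\<ge>0. delta_hyperbolic X \<delta>)"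

text \<open>
  Length of a curve parametrised by \<open>{0..1}\<close>: the supremum of the polygonal sums over all
  partitions \<open>0 = \<tau> 0 \<le> \<dots> \<le> \<tau> n = 1\<close>, possibly infinite.
\<close>

definition curve_length :: "(real \<Rightarrow> 'a::metric_space) \<Rightarrow> ennreal" where
  "curve_length g =
     (SUP (n, \<tau>) \<in> {(n :: nat, \<tau> :: nat \<Rightarrow> real).
                      \<tau> 0 = 0 \<and> \<tau> n = 1 \<and> (\<forall>i<n. \<tau> i \<le> \<tau> (Suc i))}.
        ennreal (\<Sum>i<n. dist (g (\<tau> i)) (g (\<tau> (Suc i)))))"

definition detour :: "'a::metric_space set \<Rightarrow> real \<Rightarrow> (real \<Rightarrow> 'a) \<Rightarrow> bool" where
  "detour X t g \<longleftrightarrow> path g \<and> path_image g \<subseteq> X \<and>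
     (\<exists>L. geodesic_between X (pathstart g) (pathfinish g) L \<and>
          (\<exists>z\<in>L. t \<le> infdist z (path_image g)))"

text \<open>In \<open>ennreal\<close> the infimum of the empty set is \<open>\<infinity>\<close>. Only \<open>t > 0\<close> is meaningful.\<close>

definition detour_growth :: "'a::metric_space set \<Rightarrow> real \<Rightarrow> ennreal" where
  "detour_growth X t = (INF g \<in> {g. detour X t g}. curve_length g)"

end

theory Submission
  imports Defs "HOL-Real_Asymp.Real_Asymp"
begin

text \<open>
  If \<open>X\<close> is \<open>\<delta>\<close>-hyperbolic, a curve of length at most \<open>2 ^ n\<close> comes within \<open>2 * n * \<delta> + 1\<close> of every
  point of any geodesic joining its ends, by repeated bisection
  (\<open>delta_hyperbolic_chain_close\<close>). So the length of a \<open>t\<close>-detour grows at least exponentially in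
  \<open>t\<close>, and the lower limit is infinite; the proof only records that it is at least 31.

  Conversely, suppose that all \<open>t\<close>-detours with \<open>t \<ge> T\<close> are longer than \<open>30 * t\<close>, and let \<open>D\<close> be the
  supremum of the Rips constants of the triangles of perimeter at most some bound. Take a triangle
  within the bound and a point \<open>z\<close> on one of its sides whose distance from the other two sides is at
  least \<open>9/10 * D\<close>. A detour around \<open>z\<close> of length at most \<open>26 * D\<close> is built as follows
  (\<open>fat_triangle_short_detour\<close>). Leave the side of \<open>z\<close> at points \<open>a\<close> and \<open>b\<close> at distance
  \<open>2 * D\<close> from \<open>z\<close>, or at the end of the side if it comes earlier, and reach the other sides at \<open>a'\<close>
  and \<open>b'\<close> within \<open>D\<close>. Then \<open>a'\<close> and \<open>b'\<close> are at most \<open>6 * D\<close> apart. If they lie on a common side,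
  follow it. Otherwise let \<open>w\<close> be the vertex common to their two sides. The triangle on \<open>a'\<close>, \<open>b'\<close>, \<open>w\<close>
  has no larger perimeter, hence is \<open>D\<close>-thin, and it has a short base; therefore after moving \<open>8 * D\<close>
  from \<open>a'\<close> towards \<open>w\<close> one can cross to the other leg by a geodesic no longer than \<open>D\<close> and come back
  to \<open>b'\<close>. As \<open>26 * D < 30 * (9/10 * D)\<close>, this forces \<open>9/10 * D < T\<close>, a bound that does not depend
  on the perimeter.
\<close>

section \<open>Geodesics\<close>

lemma geodesic_between_sym:
  assumes "geodesic_between X x y L"
  shows "geodesic_between X y x L"
proof -
  obtain g k where g: "g ` {0..1} \<subseteq> X" "k \<ge> 0" "g 0 = x" "g 1 = y" "L = g ` {0..1}"
    "\<forall>t\<in>{0..1}. \<forall>s\<in>{0..1}. dist (g t) (g s) = k * \<bar>t - s\<bar>"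
    using assms unfolding geodesic_between_def geodesic_def by blast
  have img: "(\<lambda>t. g (1 - t)) ` {0..1} = g ` {0..1::real}"
  proof -
    have "(\<lambda>t. 1 - t) ` {0..1} = {0..1::real}"
      by simp
    then show ?thesis
      by (metis (no_types, lifting) image_cong image_image)
  qed
  have "geodesic X (\<lambda>t. g (1 - t))"
    unfolding geodesic_def using g img
    by (intro conjI exI[of _ k]) (auto simp: abs_minus_commute)
  then show ?thesis
    unfolding geodesic_between_def using g(3-5) img
    by (intro exI[of _ "\<lambda>t. g (1 - t)"]) simp
qed

lemma geodesic_betweenE:
  assumes "geodesic_between X x y L"
  obtains g where "g ` {0..1} \<subseteq> X" "g 0 = x" "g 1 = y" "L = g ` {0..1}"
    "\<And>t s. t \<in> {0..1} \<Longrightarrow> s \<in> {0..1} \<Longrightarrow> dist (g t) (g s) = dist x y * \<bar>t - s\<bar>"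
proof -
  obtain g k where g: "g ` {0..1} \<subseteq> X" "k \<ge> 0" "g 0 = x" "g 1 = y" "L = g ` {0..1}"
    "\<forall>t\<in>{0..1}. \<forall>s\<in>{0..1}. dist (g t) (g s) = k * \<bar>t - s\<bar>"
    using assms unfolding geodesic_between_def geodesic_def by blast
  have "dist (g 0) (g 1) = k"
    using g(6) by simp
  then have k: "k = dist x y"
    using g(3,4) by simp
  show ?thesis
    by (rule that[of g]) (use g k in blast)+
qed

lemma geodesic_between_ends:
  assumes "geodesic_between X x y L"
  shows "x \<in> L" "y \<in> L" "L \<subseteq> X"
proof -
  obtain g :: "real \<Rightarrow> 'a" where "g ` {0..1} \<subseteq> X" "g 0 = x" "g 1 = y" "L = g ` {0..1}"
    using geodesic_betweenE[OF assms] by metis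
  then show "x \<in> L" "y \<in> L" "L \<subseteq> X"
    using imageI[of 0 "{0..1}" g] imageI[of 1 "{0..1}" g] by simp_all
qed

lemma geodesic_between_compact:
  assumes "geodesic_between X x y L"
  shows "compact L"
proof -
  obtain g where g: "L = g ` {0..1}"
    "\<And>t s. t \<in> {0..1} \<Longrightarrow> s \<in> {0..1} \<Longrightarrow> dist (g t) (g s) = dist x y * \<bar>t - s\<bar>"
    using geodesic_betweenE[OF assms] by metis
  have "(dist x y)-lipschitz_on {0..1} g"
    using g(2) by (intro lipschitz_onI) (auto simp: dist_real_def)
  then show ?thesis
    unfolding g(1) by (intro compact_continuous_image lipschitz_on_continuous_on) auto
qed

lemma geodesic_between_dist_add:
  assumes "geodesic_between X x y L" "p \<in> L"
  shows "dist x p + dist p y = dist x y"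
proof -
  obtain g where g: "g 0 = x" "g 1 = y" "L = g ` {0..1}"
    "\<And>t s. t \<in> {0..1} \<Longrightarrow> s \<in> {0..1} \<Longrightarrow> dist (g t) (g s) = dist x y * \<bar>t - s\<bar>"
    using geodesic_betweenE[OF assms(1)] by metis
  obtain t where t: "t \<in> {0..1}" "p = g t"
    using g assms by auto
  have "dist x p = dist x y * t" "dist p y = dist x y * (1 - t)"
    using g(4)[of 0 t] g(4)[of t 1] g(1,2) t by auto
  then show ?thesis
    by (simp add: algebra_simps)
qed

lemma geodesic_between_point:
  assumes "geodesic_between X x y L" "0 \<le> r" "r \<le> dist x y"
  obtains p where "p \<in> L" "dist x p = r"
proof -
  obtain g where g: "g 0 = x" "g 1 = y" "L = g ` {0..1}"
    "\<And>t s. t \<in> {0..1} \<Longrightarrow> s \<in> {0..1} \<Longrightarrow> dist (g t) (g s) = dist x y * \<bar>t - s\<bar>"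
    using geodesic_betweenE[OF assms(1)] by metis
  show ?thesis
  proof (cases "dist x y = 0")
    case True
    then show ?thesis
      using that[of x] geodesic_between_ends[OF assms(1)] assms by auto
  next
    case False
    have r01: "r / dist x y \<in> {0..1}"
      using assms(2,3) by (simp add: divide_le_eq_1)
    have "dist x (g (r / dist x y)) = r"
      using g(4)[OF _ r01, of 0] g(1) False assms(2) by simp
    then show ?thesis
      using that r01 g(3) by blast
  qed
qed

lemma geodesic_between_subsegment:
  assumes "geodesic_between X x y L" "p \<in> L" "q \<in> L" "dist x p \<le> dist x q"
  obtains M where "geodesic_between X p q M" "M \<subseteq> L"
    "\<And>u. u \<in> L \<Longrightarrow> dist x p \<le> dist x u \<Longrightarrow> dist x u \<le> dist x q \<Longrightarrow> u \<in> M"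
proof -
  obtain g where g: "g ` {0..1} \<subseteq> X" "g 0 = x" "g 1 = y" "L = g ` {0..1}"
    and gd: "\<And>t s. t \<in> {0..1} \<Longrightarrow> s \<in> {0..1} \<Longrightarrow> dist (g t) (g s) = dist x y * \<bar>t - s\<bar>"
    using geodesic_betweenE[OF assms(1)] by metis
  have dx: "dist x (g t) = dist x y * t" if "t \<in> {0..1}" for t
    using gd[of 0 t] that g(2) by auto
  show ?thesis
  proof (cases "dist x y = 0")
    case True
    have "u = x" if "u \<in> L" for u
    proof -
      have "dist x u \<le> 0"
        using geodesic_between_dist_add[OF assms(1) that] True zero_le_dist[of u y] by linarith
      then show ?thesis
        by simp
    qed
    then have "p = x" "q = y"
      using assms(2,3) True by auto
    then show ?thesis
      using that[of L] assms(1) by blast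
  next
    case False
    then have pos: "dist x y > 0"
      by simp
    obtain a where a: "a \<in> {0..1}" "p = g a"
      using g assms by auto
    obtain b where b: "b \<in> {0..1}" "q = g b"
      using g assms by auto
    have ab: "a \<le> b"
      using assms(4) dx a b pos by simp
    define h where "h = (\<lambda>t. g (a + t * (b - a)))"
    have in01: "a + t * (b - a) \<in> {0..1}" and inab: "a + t * (b - a) \<in> {a..b}"
      if "t \<in> {0..1}" for t
    proof -
      have "0 \<le> t * (b - a)" "t * (b - a) \<le> b - a"
        using that ab by (auto intro: mult_left_le_one_le)
      then show "a + t * (b - a) \<in> {0..1}" "a + t * (b - a) \<in> {a..b}"
        using a b by auto
    qed
    have hL: "h ` {0..1} \<subseteq> L"
      using in01 g unfolding h_def by auto
    have "dist (h t) (h s) = (dist x y * (b - a)) * \<bar>t - s\<bar>" if "t \<in> {0..1}" "s \<in> {0..1}" for t s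
    proof -
      have "\<bar>a + t * (b - a) - (a + s * (b - a))\<bar> = (b - a) * \<bar>t - s\<bar>"
        using ab by (simp add: abs_mult flip: left_diff_distrib)
      then show ?thesis
        using gd[OF in01[OF that(1)] in01[OF that(2)]] unfolding h_def by simp
    qed
    then have "geodesic X h"
      unfolding geodesic_def using hL g ab
      by (intro conjI exI[of _ "dist x y * (b - a)"]) auto
    then have "geodesic_between X p q (h ` {0..1})"
      unfolding geodesic_between_def using a b by (intro exI[of _ h]) (auto simp: h_def)
    moreover have "u \<in> h ` {0..1}"
      if u: "u \<in> L" "dist x p \<le> dist x u" "dist x u \<le> dist x q" for u
    proof -
      obtain c where c: "c \<in> {0..1}" "u = g c"
        using u g by auto
      have c_ab: "a \<le> c" "c \<le> b"
        using u dx a b c pos by auto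
      show ?thesis
      proof (cases "a = b")
        case True
        then show ?thesis
          using c_ab c by (auto simp: h_def)
      next
        case False
        then have "(c - a) / (b - a) \<in> {0..1}"
          using c_ab by auto
        moreover have "u = h ((c - a) / (b - a))"
          using c False by (simp add: h_def)
        ultimately show ?thesis
          by blast
      qed
    qed
    ultimately show ?thesis
      using that hL by blast
  qed
qed

text \<open>On compact sides the infimum in the Rips condition is attained.\<close>

lemma infdist_compact_attained:
  assumes "compact A" "A \<noteq> {}" "infdist p A \<le> r"
  obtains q where "q \<in> A" "dist p q \<le> r"
proof -
  obtain q where "q \<in> A" and q: "\<forall>u\<in>A. dist p q \<le> dist p u"
    using continuous_attains_inf[OF assms(1,2) continuous_on_dist[OF continuous_on_const continuous_on_id],
        of p] by blast
  then have "dist p q \<le> infdist p A"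
    unfolding infdist_notempty[OF assms(2)] by (intro cINF_greatest assms(2)) auto
  then show ?thesis
    using that \<open>q \<in> A\<close> assms(3) by simp
qed

section \<open>Detours in a hyperbolic space\<close>

text \<open>
  A chain of points with steps at most 1 and total length at most \<open>2 ^ n\<close> passes logarithmically
  close to every geodesic joining its ends: cutting the chain at the step that contains the middle
  of its length costs two thin triangles and halves the length.
\<close>

lemma delta_hyperbolic_chain_close:
  fixes X :: "'a::metric_space set" and p :: "nat \<Rightarrow> 'a"
  assumes hyp: "delta_hyperbolic X \<delta>" "\<delta> \<ge> 0"
    and pX: "\<And>k. k \<le> N \<Longrightarrow> p k \<in> X"
    and step: "\<And>k. k < N \<Longrightarrow> dist (p k) (p (Suc k)) \<le> 1"
  shows "i \<le> j \<Longrightarrow> j \<le> N \<Longrightarrow> (\<Sum>k=i..<j. dist (p k) (p (Suc k))) \<le> 2 ^ n \<Longrightarrow>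
    geodesic_between X (p i) (p j) L \<Longrightarrow> z \<in> L \<Longrightarrow>
    \<exists>k\<in>{i..j}. dist z (p k) \<le> 2 * real n * \<delta> + 1"
proof (induction n arbitrary: i j L z)
  case 0
  have "dist (p i) (p j) \<le> (\<Sum>k=i..<j. dist (p k) (p (Suc k)))"
    using 0(1)
  proof (induction j rule: dec_induct)
    case (step m)
    then show ?case
      using dist_triangle[of "p i" "p (Suc m)" "p m"] by simp
  qed simp
  moreover have "dist (p i) z \<le> dist (p i) (p j)"
    using geodesic_between_dist_add[OF 0(4,5)] zero_le_dist[of z "p j"] by linarith
  ultimately show ?case
    using 0 by (intro bexI[of _ i]) (auto simp: dist_commute)
next
  case (Suc n)
  have sp: "geodesic_space X"
    and thin: "\<And>L1 L2 L3. triangle_sides X L1 L2 L3 \<Longrightarrow> rips_condition \<delta> L1 L2 L3"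
    using hyp unfolding delta_hyperbolic_def by auto
  have near: "\<exists>u\<in>L2 \<union> L3. dist v u \<le> \<delta>"
    if "geodesic_between X a b L1" "geodesic_between X b c L2" "geodesic_between X c a L3" "v \<in> L1"
    for a b c L1 L2 L3 v
  proof -
    have "infdist v (L2 \<union> L3) \<le> \<delta>"
      using thin[of L1 L2 L3] that unfolding triangle_sides_def rips_condition_def by blast
    moreover have "compact (L2 \<union> L3)" "L2 \<union> L3 \<noteq> {}"
      using geodesic_between_compact[OF that(2)] geodesic_between_compact[OF that(3)]
        geodesic_between_ends[OF that(2)] by auto
    ultimately show ?thesis
      using infdist_compact_attained by metis
  qed
  define S where "S = (\<lambda>m. \<Sum>k=i..<m. dist (p k) (p (Suc k)))"
  define m where "m = Max {m \<in> {i..j}. S m \<le> 2 ^ n}"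
  have "m \<in> {m \<in> {i..j}. S m \<le> 2 ^ n}"
    unfolding m_def using Suc.prems(1) by (intro Max_in) (auto simp: S_def intro!: exI[of _ i])
  then have m: "i \<le> m" "m \<le> j" "S m \<le> 2 ^ n"
    by auto
  have next_gt: "S (Suc m) > 2 ^ n" if "m < j"
  proof (rule ccontr)
    assume "\<not> S (Suc m) > 2 ^ n"
    then have "Suc m \<in> {m \<in> {i..j}. S m \<le> 2 ^ n}"
      using m(1) that by auto
    then have "Suc m \<le> Max {m \<in> {i..j}. S m \<le> 2 ^ n}"
      by (intro Max_ge) auto
    then show False
      unfolding m_def[symmetric]
      by simp
  qed
  have mono: "2 * real n * \<delta> + 1 + 2 * \<delta> = 2 * real (Suc n) * \<delta> + 1"
    by (simp add: algebra_simps)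
  show ?case
  proof (cases "m = j")
    case True
    then obtain k where "k \<in> {i..j}" "dist z (p k) \<le> 2 * real n * \<delta> + 1"
      using Suc.IH[OF Suc.prems(1,2) _ Suc.prems(4,5)] m(3) unfolding S_def by blast
    then show ?thesis
      using mono hyp(2) by (intro bexI[of _ k]) auto
  next
    case False
    then have mj: "m < j"
      using m by simp
    \<comment> \<open>The step from \<open>m\<close> to \<open>Suc m\<close> belongs to neither half; the second triangle below cuts it off.\<close>
    have "S j = S (Suc m) + (\<Sum>k=Suc m..<j. dist (p k) (p (Suc k)))"
      unfolding S_def using m mj by (intro sum.atLeastLessThan_concat[symmetric]) auto
    then have tail: "(\<Sum>k=Suc m..<j. dist (p k) (p (Suc k))) \<le> 2 ^ n"
      using next_gt[OF mj] Suc.prems(3) unfolding S_def by simp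
    have inX: "p i \<in> X" "p m \<in> X" "p (Suc m) \<in> X" "p j \<in> X"
      using pX Suc.prems m mj by auto
    obtain A where A: "geodesic_between X (p i) (p m) A"
      using sp inX unfolding geodesic_space_def by blast
    obtain B where B: "geodesic_between X (p m) (p (Suc m)) B"
      using sp inX unfolding geodesic_space_def by blast
    obtain C where C: "geodesic_between X (p i) (p (Suc m)) C"
      using sp inX unfolding geodesic_space_def by blast
    obtain E where E: "geodesic_between X (p (Suc m)) (p j) E"
      using sp inX unfolding geodesic_space_def by blast
    obtain u where u: "u \<in> E \<union> C" "dist z u \<le> \<delta>"
      using near[OF Suc.prems(4) geodesic_between_sym[OF E] geodesic_between_sym[OF C] Suc.prems(5)]
      by blast
    show ?thesis
    proof (cases "u \<in> E")
      case True
      obtain k where "k \<in> {Suc m..j}" "dist u (p k) \<le> 2 * real n * \<delta> + 1"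
        using Suc.IH[OF _ Suc.prems(2) tail E True] mj by auto
      then show ?thesis
        using dist_triangle[of z "p k" u] u mono hyp(2) m by (intro bexI[of _ k]) auto
    next
      case False
      obtain v where v: "v \<in> B \<union> A" "dist u v \<le> \<delta>"
        using near[OF C geodesic_between_sym[OF B] geodesic_between_sym[OF A]] u False by blast
      have zv: "dist z v \<le> 2 * \<delta>"
        using dist_triangle[of z v u] u v by simp
      show ?thesis
      proof (cases "v \<in> A")
        case True
        obtain k where "k \<in> {i..m}" "dist v (p k) \<le> 2 * real n * \<delta> + 1"
          using Suc.IH[OF m(1) _ _ A True] m(3) Suc.prems m mj unfolding S_def by force
        then show ?thesis
          using dist_triangle[of z "p k" v] zv mono m by (intro bexI[of _ k]) auto
      next
        case False
        then have "dist (p m) v + dist v (p (Suc m)) = dist (p m) (p (Suc m))"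
          using v geodesic_between_dist_add[OF B] by blast
        then have "dist v (p m) \<le> 1"
          using step[of m] mj Suc.prems(2) zero_le_dist[of v "p (Suc m)"] dist_commute[of v "p m"]
          by linarith
        moreover have "0 \<le> 2 * real n * \<delta>"
          using hyp by simp
        ultimately show ?thesis
          using dist_triangle[of z "p m" v] zv mono m by (intro bexI[of _ m]) (linarith, simp)
      qed
    qed
  qed
qed

lemma delta_hyperbolic_detour_log:
  assumes hyp: "delta_hyperbolic X \<delta>" "\<delta> \<ge> 0"
    and g: "detour X t g" and len: "curve_length g \<le> ennreal (2 ^ n)"
  shows "t \<le> 2 * real n * \<delta> + 1"
proof -
  obtain L z where pg: "path g" "path_image g \<subseteq> X"
    and L: "geodesic_between X (pathstart g) (pathfinish g) L" "z \<in> L"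
    and t: "t \<le> infdist z (path_image g)"
    using g unfolding detour_def by blast
  have "uniformly_continuous_on {0..1} g"
    using pg(1) by (intro compact_uniformly_continuous) (auto simp: path_def)
  then obtain d where d: "d > 0"
    "\<And>r s. r \<in> {0..1} \<Longrightarrow> s \<in> {0..1} \<Longrightarrow> dist s r < d \<Longrightarrow> dist (g s) (g r) < 1"
    unfolding uniformly_continuous_on_def by (metis zero_less_one)
  obtain N where N: "N > 0" "1 / real N < d"
    using d(1) reals_Archimedean[of d] by (auto simp: field_simps simp del: of_nat_Suc)
  define p where "p = (\<lambda>k. g (real k / real N))"
  have in01: "real k / real N \<in> {0..1}" if "k \<le> N" for k
    using that N by auto
  have pim: "p k \<in> path_image g" if "k \<le> N" for k
    using in01[OF that] unfolding p_def path_image_def by blast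
  have step: "dist (p k) (p (Suc k)) \<le> 1" if "k < N" for k
  proof -
    have "\<bar>real k / real N - real (Suc k) / real N\<bar> = 1 / real N"
      using N by (simp add: field_simps)
    then show ?thesis
      using d(2)[OF in01[of "Suc k"] in01[of k]] that N
      unfolding p_def dist_real_def by (intro less_imp_le) simp
  qed
  have "ennreal (\<Sum>k<N. dist (p k) (p (Suc k))) \<le> curve_length g"
    unfolding curve_length_def p_def
    by (rule SUP_upper2[of "(N, \<lambda>k. real k / real N)"]) (use N in \<open>auto simp: divide_right_mono\<close>)
  then have "ennreal (\<Sum>k<N. dist (p k) (p (Suc k))) \<le> ennreal (2 ^ n)"
    using len by (rule order.trans)
  then have sum: "(\<Sum>k=0..<N. dist (p k) (p (Suc k))) \<le> 2 ^ n"
    by (simp add: atLeast0LessThan sum_nonneg)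
  have "p 0 = pathstart g" "p N = pathfinish g"
    using N by (auto simp: p_def pathstart_def pathfinish_def)
  then have "geodesic_between X (p 0) (p N) L"
    using L by simp
  then obtain k where k: "k \<in> {0..N}" "dist z (p k) \<le> 2 * real n * \<delta> + 1"
    using delta_hyperbolic_chain_close[OF hyp, of N p 0 N n L z] pim pg(2) step sum L(2) by blast
  then show ?thesis
    using infdist_le2[OF pim[of k] k(2)] t by simp
qed

lemma hyperbolic_imp_Liminf_detour_growth:
  assumes "hyperbolic X"
  shows "Liminf at_top (\<lambda>t::real. detour_growth X t / ennreal t) > 30"
proof -
  obtain \<delta> where hyp: "delta_hyperbolic X \<delta>" "\<delta> \<ge> 0"
    using assms unfolding hyperbolic_def by blast
  have "eventually (\<lambda>t::real. 2 * (ln (31 * t) / ln 2 + 1) * \<delta> + 1 < t) at_top"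
    by real_asymp
  moreover have "eventually (\<lambda>t::real. t > 1) at_top"
    by (rule eventually_gt_at_top)
  ultimately have "eventually (\<lambda>t::real. 31 \<le> detour_growth X t / ennreal t) at_top"
  proof eventually_elim
    case (elim t)
    have "ennreal (31 * t) \<le> curve_length g" if g: "detour X t g" for g
    proof (rule ccontr)
      assume "\<not> ennreal (31 * t) \<le> curve_length g"
      then have short: "curve_length g \<le> ennreal (31 * t)"
        by simp
      define n where "n = nat \<lceil>log 2 (31 * t)\<rceil>"
      have log0: "log 2 (31 * t) \<ge> 0"
        using elim by simp
      have n: "log 2 (31 * t) \<le> real n" "real n \<le> log 2 (31 * t) + 1"
        unfolding n_def using log0 by linarith+
      have "31 * t \<le> 2 powr real n"
        using n(1) elim by (simp add: log_le_iff)
      then have "31 * t \<le> 2 ^ n"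
        by (simp add: powr_realpow)
      then have "t \<le> 2 * real n * \<delta> + 1"
        using delta_hyperbolic_detour_log[OF hyp g] short by (meson ennreal_leI order.trans)
      also have "\<dots> \<le> 2 * (log 2 (31 * t) + 1) * \<delta> + 1"
        using n(2) hyp(2) by (intro add_mono mult_right_mono) auto
      finally show False
        using elim by (simp add: log_def)
    qed
    then have "ennreal (31 * t) \<le> detour_growth X t"
      unfolding detour_growth_def by (intro INF_greatest) auto
    then have "ennreal (31 * t) / ennreal t \<le> detour_growth X t / ennreal t"
      by (rule divide_right_mono_ennreal)
    then show ?case
      using elim by (simp add: divide_ennreal)
  qed
  then have "31 \<le> Liminf at_top (\<lambda>t::real. detour_growth X t / ennreal t)"
    by (rule Liminf_bounded)
  moreover have "(30::ennreal) < 31"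
    by simp
  ultimately show ?thesis
    by (rule order.strict_trans2[rotated])
qed

section \<open>Curves of controlled length\<close>

text \<open>
  There is a path from \<open>p\<close> to \<open>q\<close> inside \<open>A\<close> of length at most \<open>l\<close>. The bound is witnessed by a
  function \<open>h\<close> that dominates the length of initial arcs; unlike the supremum over all partitions,
  such witnesses are immediate to concatenate.
\<close>

definition short_curve :: "'a::metric_space set \<Rightarrow> 'a \<Rightarrow> 'a \<Rightarrow> real \<Rightarrow> bool" where
  "short_curve A p q l \<longleftrightarrow>
     (\<exists>g h. path g \<and> path_image g \<subseteq> A \<and> pathstart g = p \<and> pathfinish g = q \<and>
        (\<forall>s\<in>{0..1}. \<forall>t\<in>{0..1}. s \<le> t \<longrightarrow> dist (g s) (g t) \<le> h t - h s) \<and>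
        h 0 = (0::real) \<and> h 1 \<le> l)"

lemma short_curve_path:
  assumes "short_curve A p q l"
  obtains g where "path g" "path_image g \<subseteq> A" "pathstart g = p" "pathfinish g = q"
    "curve_length g \<le> ennreal l"
proof -
  obtain g h where g: "path g" "path_image g \<subseteq> A" "pathstart g = p" "pathfinish g = q"
    and gh: "\<And>s t. s \<in> {0..1} \<Longrightarrow> t \<in> {0..1} \<Longrightarrow> s \<le> t \<Longrightarrow> dist (g s) (g t) \<le> h t - h s"
    and h: "h 0 = (0::real)" "h 1 \<le> l"
    using assms unfolding short_curve_def by blast
  have "(\<Sum>i<n. dist (g (\<tau> i)) (g (\<tau> (Suc i)))) \<le> l"
    if \<tau>: "\<tau> 0 = 0" "\<tau> n = 1" "\<forall>i<n. \<tau> i \<le> \<tau> (Suc i)" for n and \<tau> :: "nat \<Rightarrow> real"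
  proof -
    have mono: "\<tau> i \<le> \<tau> j" if "i \<le> j" "j \<le> n" for i j
      using that
    proof (induction j rule: dec_induct)
      case (step m)
      then show ?case
        using \<tau>(3) by (meson Suc_le_eq less_imp_le order.trans)
    qed simp
    have in01: "\<tau> i \<in> {0..1}" if "i \<le> n" for i
      using mono[of 0 i] mono[of i n] \<tau> that by auto
    have "(\<Sum>i<n. dist (g (\<tau> i)) (g (\<tau> (Suc i)))) \<le> (\<Sum>i<n. h (\<tau> (Suc i)) - h (\<tau> i))"
      using \<tau>(3) in01 by (intro sum_mono gh) auto
    also have "\<dots> = h (\<tau> n) - h (\<tau> 0)"
      by (rule sum_lessThan_telescope)
    finally show ?thesis
      using \<tau> h by simp
  qed
  then have "curve_length g \<le> ennreal l"
    unfolding curve_length_def by (intro SUP_least) (auto intro!: ennreal_leI)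
  then show ?thesis
    using that g by blast
qed

lemma short_curve_join:
  assumes "short_curve A p q l" "short_curve A q r m"
  shows "short_curve A p r (l + m)"
proof -
  obtain g h where g: "path g" "path_image g \<subseteq> A" "pathstart g = p" "pathfinish g = q"
    and gh: "\<And>s t. s \<in> {0..1} \<Longrightarrow> t \<in> {0..1} \<Longrightarrow> s \<le> t \<Longrightarrow> dist (g s) (g t) \<le> h t - h s"
    and h: "h 0 = (0::real)" "h 1 \<le> l"
    using assms(1) unfolding short_curve_def by blast
  obtain g' h' where g': "path g'" "path_image g' \<subseteq> A" "pathstart g' = q" "pathfinish g' = r"
    and gh': "\<And>s t. s \<in> {0..1} \<Longrightarrow> t \<in> {0..1} \<Longrightarrow> s \<le> t \<Longrightarrow> dist (g' s) (g' t) \<le> h' t - h' s"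
    and h': "h' 0 = (0::real)" "h' 1 \<le> m"
    using assms(2) unfolding short_curve_def by blast
  define k where "k = (\<lambda>t::real. if t \<le> 1/2 then h (2 * t) else h 1 + h' (2 * t - 1))"
  have "dist ((g +++ g') s) ((g +++ g') t) \<le> k t - k s"
    if st: "s \<in> {0..1}" "t \<in> {0..1}" "s \<le> t" for s t
  proof -
    consider "t \<le> 1/2" | "s \<le> 1/2" "t > 1/2" | "s > 1/2"
      using st by linarith
    then show ?thesis
    proof cases
      case 1
      then show ?thesis
        using gh[of "2 * s" "2 * t"] st by (simp add: joinpaths_def k_def)
    next
      case 2
      have "dist (g (2 * s)) q \<le> h 1 - h (2 * s)"
        using gh[of "2 * s" 1] 2 st g(4) by (simp add: pathfinish_def)
      moreover have "dist q (g' (2 * t - 1)) \<le> h' (2 * t - 1)"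
        using gh'[of 0 "2 * t - 1"] 2 st g'(3) h' by (simp add: pathstart_def)
      ultimately show ?thesis
        using 2 dist_triangle[of "g (2 * s)" "g' (2 * t - 1)" q] by (simp add: joinpaths_def k_def)
    next
      case 3
      then show ?thesis
        using gh'[of "2 * s - 1" "2 * t - 1"] st by (simp add: joinpaths_def k_def)
    qed
  qed
  moreover have "k 0 = 0" "k 1 \<le> l + m"
    using h h' by (auto simp: k_def)
  ultimately show ?thesis
    unfolding short_curve_def using g g'
    by (intro exI[of _ "g +++ g'"] exI[of _ k]) (auto simp: path_image_join)
qed

lemma short_curve_sym:
  assumes "short_curve A p q l"
  shows "short_curve A q p l"
proof -
  obtain g h where g: "path g" "path_image g \<subseteq> A" "pathstart g = p" "pathfinish g = q"
    and gh: "\<And>s t. s \<in> {0..1} \<Longrightarrow> t \<in> {0..1} \<Longrightarrow> s \<le> t \<Longrightarrow> dist (g s) (g t) \<le> h t - h s"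
    and h: "h 0 = (0::real)" "h 1 \<le> l"
    using assms unfolding short_curve_def by blast
  have "dist (reversepath g s) (reversepath g t) \<le> (h 1 - h (1 - t)) - (h 1 - h (1 - s))"
    if "s \<in> {0..1}" "t \<in> {0..1}" "s \<le> t" for s t
    using gh[of "1 - t" "1 - s"] that by (simp add: reversepath_def dist_commute)
  then show ?thesis
    unfolding short_curve_def using g h
    by (intro exI[of _ "reversepath g"] exI[of _ "\<lambda>t. h 1 - h (1 - t)"]) auto
qed

lemma short_curve_weaken:
  assumes "short_curve A p q l" "l \<le> m"
  shows "short_curve A p q m"
proof -
  have "h 1 \<le> m" if "h 1 \<le> l" for h :: "real \<Rightarrow> real"
    using that assms(2) by simp
  then show ?thesis
    using assms(1) unfolding short_curve_def by blast
qed

lemma geodesic_between_short_curve: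
  assumes "geodesic_between X x y L" "L \<subseteq> A"
  shows "short_curve A x y (dist x y)"
proof -
  obtain g where g: "g 0 = x" "g 1 = y" "L = g ` {0..1}"
    and gd: "\<And>t s. t \<in> {0..1} \<Longrightarrow> s \<in> {0..1} \<Longrightarrow> dist (g t) (g s) = dist x y * \<bar>t - s\<bar>"
    using geodesic_betweenE[OF assms(1)] by metis
  have "(dist x y)-lipschitz_on {0..1} g"
    using gd by (auto simp: lipschitz_on_def dist_real_def)
  then have "path g"
    unfolding path_def by (rule lipschitz_on_continuous_on)
  then show ?thesis
    unfolding short_curve_def using g gd assms(2)
    by (intro exI[of _ g] exI[of _ "\<lambda>t. dist x y * t"])
      (auto simp: path_image_def pathstart_def pathfinish_def right_diff_distrib)
qed

lemma geodesic_between_short_curve_points: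
  assumes "geodesic_between X x y L" "L \<subseteq> A" "p \<in> L" "q \<in> L"
  shows "short_curve A p q (dist p q)"
proof (cases "dist x p \<le> dist x q")
  case True
  then show ?thesis
    using geodesic_between_subsegment[OF assms(1,3,4)] geodesic_between_short_curve assms(2)
    by (metis order.trans)
next
  case False
  then have "dist x q \<le> dist x p"
    by simp
  then obtain M where "geodesic_between X q p M" "M \<subseteq> L"
    using geodesic_between_subsegment[OF assms(1,4,3)] by metis
  then show ?thesis
    using geodesic_between_short_curve[OF geodesic_between_sym] assms(2) by (metis order.trans)
qed

section \<open>Short detours from fat triangles\<close>

text \<open>
  At a suitable point within \<open>2 * D\<close> of \<open>z\<close>, on the part of the geodesic before \<open>z\<close>, one can leave it
  and reach \<open>S\<close> without entering the open \<open>t\<close>-ball around \<open>z\<close>. In the application \<open>S\<close> is the union of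
  the other two sides of a triangle.
\<close>

lemma exit_to_other_sides:
  assumes sp: "geodesic_space X" and L: "geodesic_between X x y L" "z \<in> L"
    and S: "compact S" "x \<in> S" "S \<subseteq> X" "t \<le> infdist z S"
    and near: "\<And>u. u \<in> L \<Longrightarrow> infdist u S \<le> D" and D: "t \<le> D" "0 \<le> D"
  obtains a a' where "a \<in> L" "dist x a \<le> dist x z" "dist a z \<le> 2 * D" "a' \<in> S" "dist a a' \<le> D"
    "short_curve {u \<in> X. t \<le> dist z u} a a' D"
proof (cases "dist x z \<le> 2 * D")
  case True
  have "geodesic_between X x x {x}"
    unfolding geodesic_between_def geodesic_def using S by (intro exI[of _ "\<lambda>_. x"]) (auto intro!: exI[of _ 0] image_eqI[of _ _ 0])
  moreover have "{x} \<subseteq> {u \<in> X. t \<le> dist z u}"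
    using S(2-4) infdist_le[OF S(2), of z] by auto
  ultimately have "short_curve {u \<in> X. t \<le> dist z u} x x (dist x x)"
    by (rule geodesic_between_short_curve)
  then have "short_curve {u \<in> X. t \<le> dist z u} x x D"
    by (rule short_curve_weaken) (use D(2) in simp)
  then show ?thesis
    using that[of x x] True geodesic_between_ends(1)[OF L(1)] S(2) D(2) by simp
next
  case False
  have "dist x z \<le> dist x y"
    using geodesic_between_dist_add[OF L] zero_le_dist[of z y] by linarith
  then obtain a where a: "a \<in> L" "dist x a = dist x z - 2 * D"
    using geodesic_between_point[OF L(1), of "dist x z - 2 * D"] False D(2) by auto
  have le: "dist x a \<le> dist x z"
    using a(2) D(2) by simp
  obtain M where M: "geodesic_between X x z M" "M \<subseteq> L"
    "\<And>u. u \<in> L \<Longrightarrow> dist x x \<le> dist x u \<Longrightarrow> dist x u \<le> dist x z \<Longrightarrow> u \<in> M"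
    using geodesic_between_subsegment[OF L(1) geodesic_between_ends(1)[OF L(1)] L(2)] by auto
  have "dist x a + dist a z = dist x z"
    using geodesic_between_dist_add[OF M(1)] M(3)[of a] a(1) le by simp
  then have az: "dist a z = 2 * D"
    using a(2) by simp
  obtain a' where a': "a' \<in> S" "dist a a' \<le> D"
    using infdist_compact_attained[OF S(1) _ near[OF a(1)]] S(2) by blast
  obtain K where K: "geodesic_between X a a' K"
    using sp a(1) a'(1) geodesic_between_ends(3)[OF L(1)] S(3) unfolding geodesic_space_def by blast
  have "t \<le> dist z u" if "u \<in> K" for u
  proof -
    have "dist a u \<le> D"
      using geodesic_between_dist_add[OF K that] a'(2) zero_le_dist[of u a'] by linarith
    then show ?thesis
      using az D dist_triangle[of a z u] by (simp add: dist_commute)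
  qed
  then have "K \<subseteq> {u \<in> X. t \<le> dist z u}"
    using geodesic_between_ends(3)[OF K] by auto
  then have "short_curve {u \<in> X. t \<le> dist z u} a a' D"
    using geodesic_between_short_curve[OF K] a'(2) short_curve_weaken by blast
  then show ?thesis
    using that[of a a'] a(1) le az a' by simp
qed

text \<open>
  Two points on different sides, at distance at most \<open>6 * D\<close>, are joined outside the open \<open>t\<close>-ball
  around \<open>z\<close> by walking \<open>8 * D\<close> along the first side and crossing over to the second one, or through
  the common vertex \<open>w\<close> if it comes earlier. At \<open>8 * D\<close> from \<open>a\<close> the base \<open>[a, b]\<close> is farther than \<open>D\<close>
  away, so thinness leads to the second side, and the crossing is too far from \<open>z\<close> to meet the ball.
\<close>

lemma cross_between_sides:
  assumes sp: "geodesic_space X"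
    and P: "geodesic_between X a w P" and Q: "geodesic_between X b w Q"
    and PQ: "P \<union> Q \<subseteq> {u \<in> X. t \<le> dist z u}"
    and az: "dist a z \<le> 3 * D" and ab: "dist a b \<le> 6 * D" and D: "t \<le> D" "0 < D"
    and near: "\<And>B u. geodesic_between X a b B \<Longrightarrow> u \<in> P \<Longrightarrow> infdist u (B \<union> Q) \<le> D"
  shows "short_curve {u \<in> X. t \<le> dist z u} a b (24 * D)"
proof (cases "dist a w \<le> 8 * D")
  case True
  have "short_curve {u \<in> X. t \<le> dist z u} a b (dist a w + dist w b)"
    using PQ geodesic_between_short_curve[OF P] geodesic_between_short_curve[OF geodesic_between_sym[OF Q]]
    by (intro short_curve_join) auto
  moreover have "dist a w + dist w b \<le> 24 * D"
    using True ab D dist_triangle[of w b a] by (simp add: dist_commute)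
  ultimately show ?thesis
    by (rule short_curve_weaken)
next
  case False
  then obtain p where p: "p \<in> P" "dist a p = 8 * D"
    using geodesic_between_point[OF P, of "8 * D"] D by auto
  obtain B where B: "geodesic_between X a b B"
    using sp geodesic_between_ends[OF P] geodesic_between_ends[OF Q]
    unfolding geodesic_space_def by blast
  obtain q where q: "q \<in> B \<union> Q" "dist p q \<le> D"
    using infdist_compact_attained[OF _ _ near[OF B p(1)]] geodesic_between_compact[OF B]
      geodesic_between_compact[OF Q] geodesic_between_ends(1)[OF B] by blast
  have "q \<notin> B"
  proof
    assume "q \<in> B"
    then have "dist a q \<le> 6 * D"
      using geodesic_between_dist_add[OF B, of q] ab zero_le_dist[of q b] by linarith
    then show False
      using q(2) p(2) D(2) dist_triangle[of a p q] by (simp add: dist_commute)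
  qed
  then have qQ: "q \<in> Q"
    using q by simp
  obtain K where K: "geodesic_between X p q K"
    using sp p(1) qQ geodesic_between_ends(3)[OF P] geodesic_between_ends(3)[OF Q]
    unfolding geodesic_space_def by blast
  have "t \<le> dist z u" if "u \<in> K" for u
  proof -
    have "dist p u \<le> D"
      using geodesic_between_dist_add[OF K that] q(2) zero_le_dist[of u q] by linarith
    moreover have "dist a p \<le> dist a z + dist z u + dist p u"
      using dist_triangle[of a p z] dist_triangle[of z p u] by (simp add: dist_commute)
    ultimately show ?thesis
      using p(2) az D by linarith
  qed
  then have KA: "K \<subseteq> {u \<in> X. t \<le> dist z u}"
    using geodesic_between_ends(3)[OF K] by auto
  have "short_curve {u \<in> X. t \<le> dist z u} a b (dist a p + dist p q + dist q b)"
    using PQ geodesic_between_short_curve_points[OF P _ geodesic_between_ends(1)[OF P] p(1)]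
      geodesic_between_short_curve[OF K KA]
      geodesic_between_short_curve_points[OF Q _ qQ geodesic_between_ends(1)[OF Q]]
    by (intro short_curve_join) auto
  moreover have "dist a p + dist p q + dist q b \<le> 24 * D"
  proof -
    have "dist q b \<le> dist p q + dist a p + dist a b"
      using dist_triangle[of q b p] dist_triangle[of p b a] by (simp add: dist_commute)
    then show ?thesis
      using p(2) q(2) ab by linarith
  qed
  ultimately show ?thesis
    by (rule short_curve_weaken)
qed

text \<open>
  Here \<open>D\<close> is a Rips constant for all triangles whose perimeter does not exceed that of the given one.
  The conclusion is strong when \<open>t\<close> is close to \<open>D\<close>, that is, when \<open>z\<close> nearly realises this constant.
\<close>

lemma fat_triangle_short_detour:
  assumes sp: "geodesic_space X"
    and L1: "geodesic_between X x y L1" and L2: "geodesic_between X y w L2"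
    and L3: "geodesic_between X w x L3"
    and z: "z \<in> L1" "t \<le> infdist z (L2 \<union> L3)" and D: "t \<le> D" "0 < D"
    and thin: "\<And>x' y' w' K1 K2 K3 u. geodesic_between X x' y' K1 \<Longrightarrow> geodesic_between X y' w' K2 \<Longrightarrow>
      geodesic_between X w' x' K3 \<Longrightarrow>
      dist x' y' + dist y' w' + dist w' x' \<le> dist x y + dist y w + dist w x \<Longrightarrow>
      u \<in> K1 \<Longrightarrow> infdist u (K2 \<union> K3) \<le> D"
  obtains g where "detour X t g" "curve_length g \<le> ennreal (26 * D)"
proof -
  define A where "A = {u \<in> X. t \<le> dist z u}"
  define S where "S = L2 \<union> L3"
  have S: "compact S" "x \<in> S" "y \<in> S" "S \<subseteq> X"
    using geodesic_between_compact[OF L2] geodesic_between_compact[OF L3]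
      geodesic_between_ends[OF L2] geodesic_between_ends[OF L3] by (auto simp: S_def)
  have SA: "S \<subseteq> A"
    using S(4) z(2) infdist_le[of _ S z] unfolding A_def S_def[symmetric] by force
  have near: "infdist u S \<le> D" if "u \<in> L1" for u
    using thin[OF L1 L2 L3 order.refl that] unfolding S_def .
  obtain a a' where a: "a \<in> L1" "dist x a \<le> dist x z" "dist a z \<le> 2 * D" "a' \<in> S" "dist a a' \<le> D"
    and ca: "short_curve A a a' D"
    using exit_to_other_sides[OF sp L1 z(1) S(1,2,4) z(2)[folded S_def] near D(1)] D(2)
    unfolding A_def by auto
  obtain b b' where b: "b \<in> L1" "dist y b \<le> dist y z" "dist b z \<le> 2 * D" "b' \<in> S" "dist b b' \<le> D"
    and cb: "short_curve A b b' D"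
    using exit_to_other_sides[OF sp geodesic_between_sym[OF L1] z(1) S(1,3,4) z(2)[folded S_def] near D(1)]
      D(2)
    unfolding A_def by auto
  have a'z: "dist a' z \<le> 3 * D"
    using a dist_triangle[of a' z a] by (simp add: dist_commute)
  have b'z: "dist b' z \<le> 3 * D"
    using b dist_triangle[of b' z b] by (simp add: dist_commute)
  have a'b': "dist a' b' \<le> 6 * D"
    using a'z b'z dist_triangle[of a' b' z] by (simp add: dist_commute)
  have cross: "short_curve A p q (24 * D)"
    if p: "p \<in> L2" "dist p z \<le> 3 * D" and q: "q \<in> L3" and pq: "dist p q \<le> 6 * D" for p q
  proof -
    have p_le: "dist y p \<le> dist y w" and q_le: "dist x q \<le> dist x w"
      using geodesic_between_dist_add[OF L2 p(1)] geodesic_between_dist_add[OF L3 q]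
        zero_le_dist[of p w] zero_le_dist[of w q] dist_commute[of w x] dist_commute[of q x]
      by linarith+
    obtain P where P: "geodesic_between X p w P" "P \<subseteq> L2"
      using geodesic_between_subsegment[OF L2 p(1) geodesic_between_ends(2)[OF L2] p_le] by metis
    obtain Q where Q: "geodesic_between X q w Q" "Q \<subseteq> L3"
      using geodesic_between_subsegment[OF geodesic_between_sym[OF L3] q geodesic_between_ends(1)[OF L3] q_le]
      by metis
    have perim: "dist p w + dist w q + dist q p \<le> dist x y + dist y w + dist w x"
      using geodesic_between_dist_add[OF L2 p(1)] geodesic_between_dist_add[OF L3 q]
        dist_triangle[of q p x] dist_triangle[of x p y] by (simp add: dist_commute)
    have "infdist u (B \<union> Q) \<le> D" if B: "geodesic_between X p q B" "u \<in> P" for B u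
      using thin[OF P(1) geodesic_between_sym[OF Q(1)] geodesic_between_sym[OF B(1)] perim B(2)]
      by (simp add: Un_commute)
    moreover have "P \<union> Q \<subseteq> {u \<in> X. t \<le> dist z u}"
      using P(2) Q(2) SA unfolding A_def S_def by blast
    ultimately show ?thesis
      using cross_between_sides[OF sp P(1) Q(1) _ p(2) pq D] unfolding A_def by blast
  qed
  have "short_curve A a' b' (24 * D)"
  proof -
    have same: ?thesis if "geodesic_between X v v' K" "K \<subseteq> S" "a' \<in> K" "b' \<in> K" for v v' K
      using geodesic_between_short_curve_points[OF that(1) _ that(3,4)] that(2) SA a'b' D(2)
        short_curve_weaken[of A a' b' "dist a' b'" "24 * D"] by auto
    consider "a' \<in> L2" "b' \<in> L2" | "a' \<in> L3" "b' \<in> L3" | "a' \<in> L2" "b' \<in> L3" | "a' \<in> L3" "b' \<in> L2"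
      using a(4) b(4) unfolding S_def by blast
    then show ?thesis
    proof cases
      case 1
      then show ?thesis
        using same[OF L2] by (auto simp: S_def)
    next
      case 2
      then show ?thesis
        using same[OF L3] by (auto simp: S_def)
    next
      case 3
      then show ?thesis
        using cross a'z a'b' by blast
    next
      case 4
      then show ?thesis
        using short_curve_sym[OF cross[of b' a']] b'z a'b' by (simp add: dist_commute)
    qed
  qed
  then have "short_curve A a b (D + 24 * D + D)"
    using ca short_curve_sym[OF cb] by (intro short_curve_join)
  then have "short_curve A a b (26 * D)"
    by simp
  then obtain g where g: "path g" "path_image g \<subseteq> A" "pathstart g = a" "pathfinish g = b"
    "curve_length g \<le> ennreal (26 * D)"
    by (rule short_curve_path)
  have "t \<le> infdist z (path_image g)"
    using g(1,2) by (auto simp: infdist_def A_def intro!: cINF_greatest)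
  moreover obtain M where "geodesic_between X a b M" "z \<in> M"
  proof -
    have "dist x z \<le> dist x b"
      using geodesic_between_dist_add[OF L1 z(1)] geodesic_between_dist_add[OF L1 b(1)] b(2)
      by (simp add: dist_commute)
    then show ?thesis
      using geodesic_between_subsegment[OF L1 a(1) b(1)] a(2) z(1) that by (metis order.trans)
  qed
  ultimately have "detour X t g"
    unfolding detour_def using g A_def by blast
  then show ?thesis
    using that g by blast
qed

section \<open>The characterisation\<close>

lemma hyperbolic_if_long_detours:
  assumes sp: "geodesic_space X" and T: "T > 0"
    and long: "\<And>t g. t \<ge> T \<Longrightarrow> detour X t g \<Longrightarrow> curve_length g > ennreal (30 * t)"
  shows "hyperbolic X"
proof -
  have thin: "infdist z (L2 \<union> L3) \<le> 2 * T"
    if L1: "geodesic_between X x y L1" and L2: "geodesic_between X y w L2"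
      and L3: "geodesic_between X w x L3" and z: "z \<in> L1" for x y w L1 L2 L3 z
  proof (rule ccontr)
    assume fat: "\<not> infdist z (L2 \<union> L3) \<le> 2 * T"
    \<comment> \<open>Only triangles of bounded perimeter are considered, so that the supremum of \<open>R\<close> is finite.\<close>
    define R where "R = {infdist v (K2 \<union> K3) | v K1 K2 K3 x' y' w'.
      geodesic_between X x' y' K1 \<and> geodesic_between X y' w' K2 \<and> geodesic_between X w' x' K3 \<and>
      dist x' y' + dist y' w' + dist w' x' \<le> dist x y + dist y w + dist w x \<and> v \<in> K1}"
    have zR: "infdist z (L2 \<union> L3) \<in> R"
      unfolding R_def using L1 L2 L3 z by blast
    have bdd: "bdd_above R"
    proof (rule bdd_aboveI)
      fix r assume "r \<in> R"
      then obtain v K1 K2 K3 x' y' w' where v: "r = infdist v (K2 \<union> K3)"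
        "geodesic_between X x' y' K1" "geodesic_between X y' w' K2" "v \<in> K1"
        "dist x' y' + dist y' w' + dist w' x' \<le> dist x y + dist y w + dist w x"
        unfolding R_def by blast
      have "r \<le> dist v y'"
        unfolding v(1) using geodesic_between_ends(1)[OF v(3)] by (intro infdist_le) auto
      also have "\<dots> \<le> dist x' y'"
        using geodesic_between_dist_add[OF v(2,4)] zero_le_dist[of x' v] by linarith
      also have "\<dots> \<le> dist x y + dist y w + dist w x"
        using v(5) zero_le_dist[of y' w'] zero_le_dist[of w' x'] by linarith
      finally show "r \<le> dist x y + dist y w + dist w x" .
    qed
    define D where "D = Sup R"
    have D: "D > 2 * T"
      using cSup_upper[OF zR bdd] fat unfolding D_def by linarith
    then have "9 / 10 * D < Sup R"
      using T unfolding D_def by linarith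
    then obtain r where r: "r \<in> R" "9 / 10 * D < r"
      using less_cSupE zR by (metis empty_iff)
    then obtain v K1 K2 K3 x' y' w' where K: "geodesic_between X x' y' K1"
        "geodesic_between X y' w' K2" "geodesic_between X w' x' K3"
      and per: "dist x' y' + dist y' w' + dist w' x' \<le> dist x y + dist y w + dist w x"
      and v: "v \<in> K1" "9 / 10 * D \<le> infdist v (K2 \<union> K3)"
      unfolding R_def by fastforce
    have "infdist u (M2 \<union> M3) \<le> D"
      if "geodesic_between X x'' y'' M1" "geodesic_between X y'' w'' M2" "geodesic_between X w'' x'' M3"
        "dist x'' y'' + dist y'' w'' + dist w'' x'' \<le> dist x' y' + dist y' w' + dist w' x'" "u \<in> M1"
      for x'' y'' w'' M1 M2 M3 u
      unfolding D_def
    proof (rule cSup_upper[OF _ bdd])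
      show "infdist u (M2 \<union> M3) \<in> R"
        unfolding R_def using that order.trans[OF that(4) per] by blast
    qed
    moreover have "9 / 10 * D \<le> D" "0 < D"
      using D T by auto
    ultimately obtain g where g: "detour X (9 / 10 * D) g" "curve_length g \<le> ennreal (26 * D)"
      using fat_triangle_short_detour[OF sp K v] by metis
    have "curve_length g > ennreal (30 * (9 / 10 * D))"
      using long[OF _ g(1)] D T by simp
    moreover have "ennreal (26 * D) \<le> ennreal (30 * (9 / 10 * D))"
      using D T by (intro ennreal_leI) simp
    ultimately show False
      using g(2) by (meson leD order.trans)
  qed
  have "rips_condition (2 * T) L1 L2 L3" if tri: "triangle_sides X L1 L2 L3" for L1 L2 L3
  proof -
    obtain x y w where L: "geodesic_between X x y L1" "geodesic_between X y w L2"
      "geodesic_between X w x L3"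
      using tri unfolding triangle_sides_def by blast
    show ?thesis
      using thin[OF L] thin[OF L(2,3,1)] thin[OF L(3,1,2)] unfolding rips_condition_def
      by (auto simp: Un_commute)
  qed
  then show ?thesis
    unfolding hyperbolic_def delta_hyperbolic_def using sp T by (intro exI[of _ "2 * T"]) auto
qed

theorem theorem5:
  fixes X :: "'a::metric_space set"
  assumes "geodesic_space X"
  shows "hyperbolic X \<longleftrightarrow> Liminf at_top (\<lambda>t::real. detour_growth X t / ennreal t) > 30"
proof
  assume "Liminf at_top (\<lambda>t::real. detour_growth X t / ennreal t) > 30"
  then have "eventually (\<lambda>t. 30 < detour_growth X t / ennreal t) at_top"
    by (rule less_LiminfD)
  then obtain T0 where T0: "\<And>t. t \<ge> T0 \<Longrightarrow> 30 < detour_growth X t / ennreal t"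
    unfolding eventually_at_top_linorder by blast
  have "ennreal (30 * t) < curve_length g" if t: "t \<ge> max 1 T0" and g: "detour X t g" for t g
  proof -
    have "30 < detour_growth X t / ennreal t"
      using T0 t by simp
    also have "\<dots> \<le> curve_length g / ennreal t"
      unfolding detour_growth_def using g by (intro divide_right_mono_ennreal INF_lower) auto
    finally have "30 * ennreal t < curve_length g / ennreal t * ennreal t"
      using t by (intro ennreal_mult_strict_right_mono) auto
    also have "\<dots> = curve_length g"
      using t by (simp add: ennreal_divide_times)
    finally show ?thesis
      using t by (simp add: ennreal_mult')
  qed
  then show "hyperbolic X"
    using hyperbolic_if_long_detours[OF assms, of "max 1 T0"] by auto
qed (rule hyperbolic_imp_Liminf_detour_growth)

end
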